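(* Let $\mathsf{C}$ be a category with binary coproducts, let $(T,\mu,\eta)$ be a monad on $\mathsf{C}$ and let $F:\mathsf{C}\to\mathsf{C}$ be a functor that lifts to a functor $\overline{F}:\mathcal{K}l(T)\to\mathcal{K}l(T)$. Assume that $\mathcal{K}l(T)$ is a category with zero morphisms $0_{X,Y}:X\rightsquigarrow Y$. Define on the endofunctor $\overline{F}+\mathcal{I}d$ of $\mathcal{K}l(T)$ the natural transformations $e:\mathcal{I}d\Rightarrow \overline{F}+\mathcal{I}d$, $e=\mathsf{inr}$, and $$m:\overline{F}(\overline{F}+\mathcal{I}d)+(\overline{F}+\mathcal{I}d)\xrightarrow{\ \overline{F}([0,id])+id\ } \overline{F}+(\overline{F}+\mathcal{I}d)\xrightarrow{\ [\mathsf{inl},id]\ }\overline{F}+\mathcal{I}d,$$ where $[0,id]:\overline{F}X+X\rightsquigarrow X$ is the cotuple of the zero morphism $0_{FX,X}$ and the identity. Then $(\overline{F}+\mathcal{I}d,m,e)$ is a monad on $\mathcal{K}l(T)$.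
   Context: For a monad $(T,\mu,\eta)$ on $\mathsf{C}$, the Kleisli category $\mathcal{K}l(T)$ has the objects of $\mathsf{C}$; a morphism $f:X\rightsquigarrow Y$ is a morphism $f:X\to TY$ of $\mathsf{C}$; composition is $g\cdot f=\mu_Z\circ Tg\circ f$ and identities are $1_X=\eta_X$. For $f:X\to Y$ in $\mathsf{C}$ put $f^\sharp=\eta_Y\circ f:X\rightsquigarrow Y$. A functor $F$ on $\mathsf{C}$ lifts to $\overline{F}$ on $\mathcal{K}l(T)$ if $\overline{F}X=FX$ and $\overline{F}(f^\sharp)=(Ff)^\sharp$ for all $f$ of $\mathsf{C}$ (equivalently, $\overline{F}g=\lambda_Y\circ Fg$ for a distributive law $\lambda:FT\Rightarrow TF$). Coproducts in $\mathcal{K}l(T)$ are those of $\mathsf{C}$: $X+Y$ with coprojections $\mathsf{inl}^\sharp,\mathsf{inr}^\sharp$ (written $\mathsf{inl},\mathsf{inr}$), and cotupling in $\mathcal{K}l(T)$ is cotupling in $\mathsf{C}$. A category has zero morphisms if for all objects $X,Y$ there is $0_{X,Y}:X\to Y$ with $f\circ 0_{X,Y}=0_{X,Z}=0_{Y,Z}\circ g$ for all $f:Y\to Z$, $g:X\to Y$. *)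

theory Defs
  imports Main
begin

text \<open>
  A category is given by a family of hom-sets. The hom-sets need not be pairwise disjoint, hence
  composition is indexed by the objects involved: \<open>Comp C X Y Z g f\<close> is the composite of
  \<open>f : X \<rightarrow> Y\<close> and \<open>g : Y \<rightarrow> Z\<close>. In this way a Kleisli morphism from \<open>X\<close> to \<open>Y\<close> is literally a
  morphism from \<open>X\<close> to \<open>T Y\<close>, even if \<open>T\<close> is not injective on objects.
\<close>

record ('o, 'm) cat =
  Ob :: "'o set"
  Hom :: "'o \<Rightarrow> 'o \<Rightarrow> 'm set"
  Id :: "'o \<Rightarrow> 'm"
  Comp :: "'o \<Rightarrow> 'o \<Rightarrow> 'o \<Rightarrow> 'm \<Rightarrow> 'm \<Rightarrow> 'm"

definition category :: "('o, 'm) cat \<Rightarrow> bool" where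
  "category C \<longleftrightarrow>
     (\<forall>X\<in>Ob C. Id C X \<in> Hom C X X) \<and>
     (\<forall>X\<in>Ob C. \<forall>Y\<in>Ob C. \<forall>Z\<in>Ob C. \<forall>f\<in>Hom C X Y. \<forall>g\<in>Hom C Y Z.
        Comp C X Y Z g f \<in> Hom C X Z) \<and>
     (\<forall>X\<in>Ob C. \<forall>Y\<in>Ob C. \<forall>f\<in>Hom C X Y.
        Comp C X X Y f (Id C X) = f \<and> Comp C X Y Y (Id C Y) f = f) \<and>
     (\<forall>W\<in>Ob C. \<forall>X\<in>Ob C. \<forall>Y\<in>Ob C. \<forall>Z\<in>Ob C.
        \<forall>f\<in>Hom C W X. \<forall>g\<in>Hom C X Y. \<forall>h\<in>Hom C Y Z.
        Comp C W X Z (Comp C X Y Z h g) f = Comp C W Y Z h (Comp C W X Y g f))"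

text \<open>\<open>Map F X Y f\<close> is the action of \<open>F\<close> on \<open>f : X \<rightarrow> Y\<close>.\<close>

record ('o, 'm, 'p, 'n) func =
  Fob :: "'o \<Rightarrow> 'p"
  Map :: "'o \<Rightarrow> 'o \<Rightarrow> 'm \<Rightarrow> 'n"

definition is_functor :: "('o, 'm) cat \<Rightarrow> ('p, 'n) cat \<Rightarrow> ('o, 'm, 'p, 'n) func \<Rightarrow> bool" where
  "is_functor C D F \<longleftrightarrow>
     category C \<and> category D \<and>
     (\<forall>X\<in>Ob C. Fob F X \<in> Ob D) \<and>
     (\<forall>X\<in>Ob C. \<forall>Y\<in>Ob C. \<forall>f\<in>Hom C X Y. Map F X Y f \<in> Hom D (Fob F X) (Fob F Y)) \<and>
     (\<forall>X\<in>Ob C. Map F X X (Id C X) = Id D (Fob F X)) \<and>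
     (\<forall>X\<in>Ob C. \<forall>Y\<in>Ob C. \<forall>Z\<in>Ob C. \<forall>f\<in>Hom C X Y. \<forall>g\<in>Hom C Y Z.
        Map F X Z (Comp C X Y Z g f) =
        Comp D (Fob F X) (Fob F Y) (Fob F Z) (Map F Y Z g) (Map F X Y f))"

definition id_func :: "('o, 'm, 'o, 'm) func" where
  "id_func = \<lparr>Fob = (\<lambda>X. X), Map = (\<lambda>X Y f. f)\<rparr>"

definition comp_func ::
    "('p, 'n, 'q, 'k) func \<Rightarrow> ('o, 'm, 'p, 'n) func \<Rightarrow> ('o, 'm, 'q, 'k) func" where
  "comp_func G F =
     \<lparr>Fob = (\<lambda>X. Fob G (Fob F X)),
      Map = (\<lambda>X Y f. Map G (Fob F X) (Fob F Y) (Map F X Y f))\<rparr>"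

definition nat_trans ::
    "('o, 'm) cat \<Rightarrow> ('p, 'n) cat \<Rightarrow> ('o, 'm, 'p, 'n) func \<Rightarrow> ('o, 'm, 'p, 'n) func \<Rightarrow>
     ('o \<Rightarrow> 'n) \<Rightarrow> bool" where
  "nat_trans C D F G \<alpha> \<longleftrightarrow>
     is_functor C D F \<and> is_functor C D G \<and>
     (\<forall>X\<in>Ob C. \<alpha> X \<in> Hom D (Fob F X) (Fob G X)) \<and>
     (\<forall>X\<in>Ob C. \<forall>Y\<in>Ob C. \<forall>f\<in>Hom C X Y.
        Comp D (Fob F X) (Fob F Y) (Fob G Y) (\<alpha> Y) (Map F X Y f) =
        Comp D (Fob F X) (Fob G X) (Fob G Y) (Map G X Y f) (\<alpha> X))"

definition is_monad ::
    "('o, 'm) cat \<Rightarrow> ('o, 'm, 'o, 'm) func \<Rightarrow> ('o \<Rightarrow> 'm) \<Rightarrow> ('o \<Rightarrow> 'm) \<Rightarrow> bool" where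
  "is_monad C T \<mu> \<eta> \<longleftrightarrow>
     is_functor C C T \<and>
     nat_trans C C (comp_func T T) T \<mu> \<and>
     nat_trans C C id_func T \<eta> \<and>
     (\<forall>X\<in>Ob C.
        Comp C (Fob T (Fob T (Fob T X))) (Fob T (Fob T X)) (Fob T X)
          (\<mu> X) (Map T (Fob T (Fob T X)) (Fob T X) (\<mu> X)) =
        Comp C (Fob T (Fob T (Fob T X))) (Fob T (Fob T X)) (Fob T X)
          (\<mu> X) (\<mu> (Fob T X))) \<and>
     (\<forall>X\<in>Ob C.
        Comp C (Fob T X) (Fob T (Fob T X)) (Fob T X)
          (\<mu> X) (Map T X (Fob T X) (\<eta> X)) = Id C (Fob T X) \<and>
        Comp C (Fob T X) (Fob T (Fob T X)) (Fob T X)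
          (\<mu> X) (\<eta> (Fob T X)) = Id C (Fob T X))"

definition kleisli ::
    "('o, 'm) cat \<Rightarrow> ('o, 'm, 'o, 'm) func \<Rightarrow> ('o \<Rightarrow> 'm) \<Rightarrow> ('o \<Rightarrow> 'm) \<Rightarrow> ('o, 'm) cat" where
  "kleisli C T \<mu> \<eta> =
     \<lparr>Ob = Ob C,
      Hom = (\<lambda>X Y. Hom C X (Fob T Y)),
      Id = \<eta>,
      Comp = (\<lambda>X Y Z g f.
        Comp C X (Fob T (Fob T Z)) (Fob T Z) (\<mu> Z)
          (Comp C X (Fob T Y) (Fob T (Fob T Z)) (Map T Y (Fob T Z) g) f))\<rparr>"

text \<open>The Kleisli morphism \<open>f\<^sup>\<sharp>\<close> induced by \<open>f : X \<rightarrow> Y\<close>.\<close>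

definition sharp ::
    "('o, 'm) cat \<Rightarrow> ('o, 'm, 'o, 'm) func \<Rightarrow> ('o \<Rightarrow> 'm) \<Rightarrow> 'o \<Rightarrow> 'o \<Rightarrow> 'm \<Rightarrow> 'm" where
  "sharp C T \<eta> X Y f = Comp C X Y (Fob T Y) (\<eta> Y) f"

definition is_lifting ::
    "('o, 'm) cat \<Rightarrow> ('o, 'm, 'o, 'm) func \<Rightarrow> ('o \<Rightarrow> 'm) \<Rightarrow> ('o \<Rightarrow> 'm) \<Rightarrow>
     ('o, 'm, 'o, 'm) func \<Rightarrow> ('o, 'm, 'o, 'm) func \<Rightarrow> bool" where
  "is_lifting C T \<mu> \<eta> F F' \<longleftrightarrow>
     is_functor (kleisli C T \<mu> \<eta>) (kleisli C T \<mu> \<eta>) F' \<and>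
     (\<forall>X\<in>Ob C. Fob F' X = Fob F X) \<and>
     (\<forall>X\<in>Ob C. \<forall>Y\<in>Ob C. \<forall>f\<in>Hom C X Y.
        Map F' X Y (sharp C T \<eta> X Y f) = sharp C T \<eta> (Fob F X) (Fob F Y) (Map F X Y f))"

text \<open>Chosen binary coproduct objects together with their coprojections.\<close>

record ('o, 'm) coprods =
  Sum :: "'o \<Rightarrow> 'o \<Rightarrow> 'o"
  inl :: "'o \<Rightarrow> 'o \<Rightarrow> 'm"
  inr :: "'o \<Rightarrow> 'o \<Rightarrow> 'm"

definition is_cotuple ::
    "('o, 'm) cat \<Rightarrow> ('o, 'm) coprods \<Rightarrow> 'o \<Rightarrow> 'o \<Rightarrow> 'o \<Rightarrow> 'm \<Rightarrow> 'm \<Rightarrow> 'm \<Rightarrow> bool" where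
  "is_cotuple C P X Y Z f g h \<longleftrightarrow>
     h \<in> Hom C (Sum P X Y) Z \<and>
     Comp C X (Sum P X Y) Z h (inl P X Y) = f \<and>
     Comp C Y (Sum P X Y) Z h (inr P X Y) = g"

definition binary_coproducts :: "('o, 'm) cat \<Rightarrow> ('o, 'm) coprods \<Rightarrow> bool" where
  "binary_coproducts C P \<longleftrightarrow>
     (\<forall>X\<in>Ob C. \<forall>Y\<in>Ob C.
        Sum P X Y \<in> Ob C \<and>
        inl P X Y \<in> Hom C X (Sum P X Y) \<and>
        inr P X Y \<in> Hom C Y (Sum P X Y) \<and>
        (\<forall>Z\<in>Ob C. \<forall>f\<in>Hom C X Z. \<forall>g\<in>Hom C Y Z. \<exists>!h. is_cotuple C P X Y Z f g h))"

definition cotuple ::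
    "('o, 'm) cat \<Rightarrow> ('o, 'm) coprods \<Rightarrow> 'o \<Rightarrow> 'o \<Rightarrow> 'o \<Rightarrow> 'm \<Rightarrow> 'm \<Rightarrow> 'm" where
  "cotuple C P X Y Z f g = (THE h. is_cotuple C P X Y Z f g h)"

text \<open>\<open>f + g : X + Y \<rightarrow> X' + Y'\<close> for \<open>f : X \<rightarrow> X'\<close> and \<open>g : Y \<rightarrow> Y'\<close>.\<close>

definition sum_map ::
    "('o, 'm) cat \<Rightarrow> ('o, 'm) coprods \<Rightarrow> 'o \<Rightarrow> 'o \<Rightarrow> 'o \<Rightarrow> 'o \<Rightarrow> 'm \<Rightarrow> 'm \<Rightarrow> 'm" where
  "sum_map C P X Y X' Y' f g =
     cotuple C P X Y (Sum P X' Y')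
       (Comp C X X' (Sum P X' Y') (inl P X' Y') f)
       (Comp C Y Y' (Sum P X' Y') (inr P X' Y') g)"

definition sum_func ::
    "('p, 'n) cat \<Rightarrow> ('p, 'n) coprods \<Rightarrow> ('o, 'm, 'p, 'n) func \<Rightarrow> ('o, 'm, 'p, 'n) func \<Rightarrow>
     ('o, 'm, 'p, 'n) func" where
  "sum_func D P F G =
     \<lparr>Fob = (\<lambda>X. Sum P (Fob F X) (Fob G X)),
      Map = (\<lambda>X Y f.
        sum_map D P (Fob F X) (Fob G X) (Fob F Y) (Fob G Y) (Map F X Y f) (Map G X Y f))\<rparr>"

text \<open>
  The coproducts of \<open>C\<close> as coproducts of the Kleisli category; see \<open>binary_coproducts_kleisli\<close> and
  \<open>cotuple_kleisli\<close> below.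
\<close>

definition kleisli_coprods ::
    "('o, 'm) cat \<Rightarrow> ('o, 'm, 'o, 'm) func \<Rightarrow> ('o \<Rightarrow> 'm) \<Rightarrow> ('o, 'm) coprods \<Rightarrow>
     ('o, 'm) coprods" where
  "kleisli_coprods C T \<eta> P =
     \<lparr>Sum = Sum P,
      inl = (\<lambda>X Y. sharp C T \<eta> X (Sum P X Y) (inl P X Y)),
      inr = (\<lambda>X Y. sharp C T \<eta> Y (Sum P X Y) (inr P X Y))\<rparr>"

definition zero_morphisms :: "('o, 'm) cat \<Rightarrow> ('o \<Rightarrow> 'o \<Rightarrow> 'm) \<Rightarrow> bool" where
  "zero_morphisms C z \<longleftrightarrow>
     category C \<and>
     (\<forall>X\<in>Ob C. \<forall>Y\<in>Ob C. z X Y \<in> Hom C X Y) \<and>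
     (\<forall>X\<in>Ob C. \<forall>Y\<in>Ob C. \<forall>Z\<in>Ob C. \<forall>f\<in>Hom C Y Z. \<forall>g\<in>Hom C X Y.
        Comp C X Y Z f (z X Y) = z X Z \<and> Comp C X Y Z (z Y Z) g = z X Z)"

text \<open>
  The following two families of morphisms are defined in an arbitrary category \<open>K\<close> with binary
  coproducts \<open>P\<close>, zero morphisms \<open>z\<close> and endofunctor \<open>G\<close>; the component of the multiplication is
  \<open>[inl, id] \<cdot> (G [0, id] + id) : G (G X + X) + (G X + X) \<rightarrow> G X + (G X + X) \<rightarrow> G X + X\<close>.
\<close>

definition sum_id_unit ::
    "('o, 'm) coprods \<Rightarrow> ('o, 'm, 'o, 'm) func \<Rightarrow> 'o \<Rightarrow> 'm" where
  "sum_id_unit P G X = inr P (Fob G X) X"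

definition sum_id_mult ::
    "('o, 'm) cat \<Rightarrow> ('o, 'm) coprods \<Rightarrow> ('o \<Rightarrow> 'o \<Rightarrow> 'm) \<Rightarrow> ('o, 'm, 'o, 'm) func \<Rightarrow>
     'o \<Rightarrow> 'm" where
  "sum_id_mult K P z G X =
     (let GX = Fob G X; S = Sum P GX X; GS = Fob G S in
      Comp K (Sum P GS S) (Sum P GX S) S
        (cotuple K P GX S S (inl P GX X) (Id K S))
        (sum_map K P GS S GX S
           (Map G S X (cotuple K P GX X X (z GX X) (Id K X)))
           (Id K S)))"


lemma monad_sharp_comp:
  assumes "is_monad C T \<mu> \<eta>" "X \<in> Ob C" "Y \<in> Ob C" "Z \<in> Ob C"
    and f: "f \<in> Hom C X Y" and h: "h \<in> Hom C Y (Fob T Z)"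
  shows "Comp (kleisli C T \<mu> \<eta>) X Y Z h (sharp C T \<eta> X Y f) = Comp C X Y (Fob T Z) h f"
proof -
  let ?TY = "Fob T Y" and ?TZ = "Fob T Z" and ?TTZ = "Fob T (Fob T Z)"
  have cat: "category C" and fun_T: "is_functor C C T"
    and nat\<mu>: "nat_trans C C (comp_func T T) T \<mu>" and nat\<eta>: "nat_trans C C id_func T \<eta>"
    using assms(1) by (auto simp: is_monad_def is_functor_def)
  have ob: "?TY \<in> Ob C" "?TZ \<in> Ob C" "?TTZ \<in> Ob C"
    using fun_T assms(3,4) by (auto simp: is_functor_def)
  have \<eta>Y: "\<eta> Y \<in> Hom C Y ?TY" and \<eta>TZ: "\<eta> ?TZ \<in> Hom C ?TZ ?TTZ"
    using nat\<eta> assms(3) ob by (auto simp: nat_trans_def id_func_def)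
  have \<mu>Z: "\<mu> Z \<in> Hom C ?TTZ ?TZ"
    using nat\<mu> assms(4) by (auto simp: nat_trans_def comp_func_def)
  have Th: "Map T Y ?TZ h \<in> Hom C ?TY ?TTZ"
    using fun_T assms(3) ob h by (auto simp: is_functor_def)
  have assoc: "Comp C W A D (Comp C A B D t s) r = Comp C W B D t (Comp C W A B s r)"
    if "W \<in> Ob C" "A \<in> Ob C" "B \<in> Ob C" "D \<in> Ob C"
      "r \<in> Hom C W A" "s \<in> Hom C A B" "t \<in> Hom C B D" for W A B D r s t
    using cat that unfolding category_def by blast
  have nat: "Comp C Y ?TY ?TTZ (Map T Y ?TZ h) (\<eta> Y) = Comp C Y ?TZ ?TTZ (\<eta> ?TZ) h"
    using nat\<eta> assms(3) ob h by (auto simp: nat_trans_def id_func_def)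
  have hf: "Comp C X Y ?TZ h f \<in> Hom C X ?TZ"
    using cat assms(2,3) ob f h unfolding category_def by blast
  have "Comp C X ?TY ?TTZ (Map T Y ?TZ h) (Comp C X Y ?TY (\<eta> Y) f) =
        Comp C X Y ?TTZ (Comp C Y ?TY ?TTZ (Map T Y ?TZ h) (\<eta> Y)) f"
    using assoc[OF assms(2,3) ob(1,3) f \<eta>Y Th] by simp
  also have "\<dots> = Comp C X ?TZ ?TTZ (\<eta> ?TZ) (Comp C X Y ?TZ h f)"
    unfolding nat by (rule assoc[OF assms(2,3) ob(2,3) f h \<eta>TZ])
  finally have "Comp (kleisli C T \<mu> \<eta>) X Y Z h (sharp C T \<eta> X Y f) =
        Comp C X ?TTZ ?TZ (\<mu> Z) (Comp C X ?TZ ?TTZ (\<eta> ?TZ) (Comp C X Y ?TZ h f))"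
    by (simp add: kleisli_def sharp_def)
  also have "\<dots> = Comp C X ?TZ ?TZ (Comp C ?TZ ?TTZ ?TZ (\<mu> Z) (\<eta> ?TZ)) (Comp C X Y ?TZ h f)"
    using assoc[OF assms(2) ob(2,3,2) hf \<eta>TZ \<mu>Z] by simp
  also have "\<dots> = Comp C X Y ?TZ h f"
    using assms(1,2,4) cat ob hf by (simp add: is_monad_def category_def)
  finally show ?thesis .
qed

lemma is_cotuple_kleisli:
  assumes "is_monad C T \<mu> \<eta>" "binary_coproducts C P" "X \<in> Ob C" "Y \<in> Ob C" "Z \<in> Ob C"
  shows "is_cotuple (kleisli C T \<mu> \<eta>) (kleisli_coprods C T \<eta> P) X Y Z f g h \<longleftrightarrow>
         is_cotuple C P X Y (Fob T Z) f g h"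
proof -
  have S: "Sum P X Y \<in> Ob C" "inl P X Y \<in> Hom C X (Sum P X Y)" "inr P X Y \<in> Hom C Y (Sum P X Y)"
    using assms by (auto simp: binary_coproducts_def)
  have H: "h \<in> Hom (kleisli C T \<mu> \<eta>) (Sum P X Y) Z \<longleftrightarrow> h \<in> Hom C (Sum P X Y) (Fob T Z)"
    by (simp add: kleisli_def)
  show ?thesis
    using monad_sharp_comp[OF assms(1,3) S(1) assms(5) S(2)]
      monad_sharp_comp[OF assms(1,4) S(1) assms(5) S(3)] H
    by (auto simp: is_cotuple_def kleisli_coprods_def)
qed

lemma cotuple_kleisli:
  assumes "is_monad C T \<mu> \<eta>" "binary_coproducts C P" "X \<in> Ob C" "Y \<in> Ob C" "Z \<in> Ob C"
  shows "cotuple (kleisli C T \<mu> \<eta>) (kleisli_coprods C T \<eta> P) X Y Z f g =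
         cotuple C P X Y (Fob T Z) f g"
  by (simp add: cotuple_def is_cotuple_kleisli[OF assms])

lemma binary_coproducts_kleisli:
  assumes "is_monad C T \<mu> \<eta>" "binary_coproducts C P"
  shows "binary_coproducts (kleisli C T \<mu> \<eta>) (kleisli_coprods C T \<eta> P)"
proof -
  have cat: "category C" and T: "\<And>X. X \<in> Ob C \<Longrightarrow> Fob T X \<in> Ob C"
    and \<eta>: "\<And>X. X \<in> Ob C \<Longrightarrow> \<eta> X \<in> Hom C X (Fob T X)"
    using assms(1) by (auto simp: is_monad_def is_functor_def nat_trans_def id_func_def)
  have sharp: "sharp C T \<eta> X Y f \<in> Hom C X (Fob T Y)"
    if "X \<in> Ob C" "Y \<in> Ob C" "f \<in> Hom C X Y" for X Y f
    using that cat T \<eta> unfolding sharp_def category_def by blast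
  have P: "Sum P X Y \<in> Ob C" "inl P X Y \<in> Hom C X (Sum P X Y)" "inr P X Y \<in> Hom C Y (Sum P X Y)"
    "\<And>Z f g. Z \<in> Ob C \<Longrightarrow> f \<in> Hom C X Z \<Longrightarrow> g \<in> Hom C Y Z \<Longrightarrow> \<exists>!h. is_cotuple C P X Y Z f g h"
    if "X \<in> Ob C" "Y \<in> Ob C" for X Y
    using assms(2) that unfolding binary_coproducts_def by blast+
  have K: "Ob (kleisli C T \<mu> \<eta>) = Ob C" "\<And>X Y. Hom (kleisli C T \<mu> \<eta>) X Y = Hom C X (Fob T Y)"
    by (simp_all add: kleisli_def)
  have Q: "Sum (kleisli_coprods C T \<eta> P) = Sum P"
    "inl (kleisli_coprods C T \<eta> P) = (\<lambda>X Y. sharp C T \<eta> X (Sum P X Y) (inl P X Y))"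
    "inr (kleisli_coprods C T \<eta> P) = (\<lambda>X Y. sharp C T \<eta> Y (Sum P X Y) (inr P X Y))"
    by (simp_all add: kleisli_coprods_def)
  show ?thesis
    unfolding binary_coproducts_def K Q
    by (intro ballI conjI) (simp_all add: P sharp T ext[OF is_cotuple_kleisli[OF assms]])
qed

end

theory Submission
  imports Defs
begin

text \<open>
  The claim holds for an endofunctor \<open>G\<close> of any category with binary coproducts and zero
  morphisms. With \<open>p = [0, id] : G X + X \<rightarrow> X\<close> the multiplication is
  \<open>m = [inl \<cdot> G p, id]\<close>, so on the right summand all monad laws are trivial, and on the left
  summand they reduce to \<open>p\<close> being natural with \<open>p \<cdot> inr = id\<close> and \<open>p \<cdot> m = p \<cdot> p\<close>. The last
  equation holds since both sides vanish on the left summand and equal \<open>p\<close> on the right one.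
\<close>

locale coproduct_category =
  fixes K :: "('o, 'm) cat" and P :: "('o, 'm) coprods"
  assumes category: "category K"
    and binary_coproducts: "binary_coproducts K P"
begin

lemma Id_in_Hom [simp]: "X \<in> Ob K \<Longrightarrow> Id K X \<in> Hom K X X"
  using category by (simp add: category_def)

lemma Comp_in_Hom [simp]:
  "\<lbrakk>X \<in> Ob K; Y \<in> Ob K; Z \<in> Ob K; f \<in> Hom K X Y; g \<in> Hom K Y Z\<rbrakk>
    \<Longrightarrow> Comp K X Y Z g f \<in> Hom K X Z"
  using category unfolding category_def by blast

lemma Comp_Id_right [simp]:
  "\<lbrakk>X \<in> Ob K; Y \<in> Ob K; f \<in> Hom K X Y\<rbrakk> \<Longrightarrow> Comp K X X Y f (Id K X) = f"
  using category by (simp add: category_def)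

lemma Comp_Id_left [simp]:
  "\<lbrakk>X \<in> Ob K; Y \<in> Ob K; f \<in> Hom K X Y\<rbrakk> \<Longrightarrow> Comp K X Y Y (Id K Y) f = f"
  using category by (simp add: category_def)

lemma Comp_assoc:
  "\<lbrakk>W \<in> Ob K; X \<in> Ob K; Y \<in> Ob K; Z \<in> Ob K;
    f \<in> Hom K W X; g \<in> Hom K X Y; h \<in> Hom K Y Z\<rbrakk>
    \<Longrightarrow> Comp K W X Z (Comp K X Y Z h g) f = Comp K W Y Z h (Comp K W X Y g f)"
  using category unfolding category_def by blast

lemma Sum_in_Ob [simp]: "\<lbrakk>X \<in> Ob K; Y \<in> Ob K\<rbrakk> \<Longrightarrow> Sum P X Y \<in> Ob K"
  and inl_in_Hom [simp]: "\<lbrakk>X \<in> Ob K; Y \<in> Ob K\<rbrakk> \<Longrightarrow> inl P X Y \<in> Hom K X (Sum P X Y)"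
  and inr_in_Hom [simp]: "\<lbrakk>X \<in> Ob K; Y \<in> Ob K\<rbrakk> \<Longrightarrow> inr P X Y \<in> Hom K Y (Sum P X Y)"
  using binary_coproducts by (simp_all add: binary_coproducts_def)

lemma ex1_cotuple:
  "\<lbrakk>X \<in> Ob K; Y \<in> Ob K; Z \<in> Ob K; f \<in> Hom K X Z; g \<in> Hom K Y Z\<rbrakk>
    \<Longrightarrow> \<exists>!h. is_cotuple K P X Y Z f g h"
  using binary_coproducts unfolding binary_coproducts_def by blast

lemma is_cotuple_cotuple:
  "\<lbrakk>X \<in> Ob K; Y \<in> Ob K; Z \<in> Ob K; f \<in> Hom K X Z; g \<in> Hom K Y Z\<rbrakk>
    \<Longrightarrow> is_cotuple K P X Y Z f g (cotuple K P X Y Z f g)"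
  unfolding cotuple_def by (rule theI', rule ex1_cotuple)

context
  fixes X Y Z f g
  assumes asm: "X \<in> Ob K" "Y \<in> Ob K" "Z \<in> Ob K" "f \<in> Hom K X Z" "g \<in> Hom K Y Z"
begin

lemma cotuple_in_Hom [simp]: "cotuple K P X Y Z f g \<in> Hom K (Sum P X Y) Z"
  and cotuple_inl [simp]: "Comp K X (Sum P X Y) Z (cotuple K P X Y Z f g) (inl P X Y) = f"
  and cotuple_inr [simp]: "Comp K Y (Sum P X Y) Z (cotuple K P X Y Z f g) (inr P X Y) = g"
  using is_cotuple_cotuple[OF asm] by (simp_all add: is_cotuple_def)

text \<open>\<open>Comp_assoc\<close> brackets to the right, which hides the pattern of
  \<open>cotuple_inl\<close> as soon as another morphism \<open>k\<close> precedes the coprojection.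
  This rule and the next let simp compute in that case too.\<close>

lemma cotuple_inl_Comp [simp]:
  "\<lbrakk>W \<in> Ob K; k \<in> Hom K W X\<rbrakk> \<Longrightarrow>
    Comp K W (Sum P X Y) Z (cotuple K P X Y Z f g) (Comp K W X (Sum P X Y) (inl P X Y) k) =
    Comp K W X Z f k"
  using Comp_assoc[of W X "Sum P X Y" Z k "inl P X Y" "cotuple K P X Y Z f g"] asm by simp

lemma cotuple_inr_Comp [simp]:
  "\<lbrakk>W \<in> Ob K; k \<in> Hom K W Y\<rbrakk> \<Longrightarrow>
    Comp K W (Sum P X Y) Z (cotuple K P X Y Z f g) (Comp K W Y (Sum P X Y) (inr P X Y) k) =
    Comp K W Y Z g k"
  using Comp_assoc[of W Y "Sum P X Y" Z k "inr P X Y" "cotuple K P X Y Z f g"] asm by simp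

end

text \<open>The coprojections are jointly epic, by uniqueness of cotuples. The equations below
  between morphisms out of a sum are split into their two summands this way.\<close>

lemma Sum_ext:
  assumes "X \<in> Ob K" "Y \<in> Ob K" "Z \<in> Ob K"
    and "h \<in> Hom K (Sum P X Y) Z" "k \<in> Hom K (Sum P X Y) Z"
    and "Comp K X (Sum P X Y) Z h (inl P X Y) = Comp K X (Sum P X Y) Z k (inl P X Y)"
    and "Comp K Y (Sum P X Y) Z h (inr P X Y) = Comp K Y (Sum P X Y) Z k (inr P X Y)"
  shows "h = k"
proof -
  let ?f = "Comp K X (Sum P X Y) Z k (inl P X Y)" and ?g = "Comp K Y (Sum P X Y) Z k (inr P X Y)"
  have "\<exists>!h. is_cotuple K P X Y Z ?f ?g h"
    using assms by (intro ex1_cotuple) simp_all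
  moreover have "is_cotuple K P X Y Z ?f ?g h" "is_cotuple K P X Y Z ?f ?g k"
    using assms by (simp_all add: is_cotuple_def)
  ultimately show ?thesis by blast
qed

lemma cotuple_inl_inr:
  assumes "X \<in> Ob K" "Y \<in> Ob K"
  shows "cotuple K P X Y (Sum P X Y) (inl P X Y) (inr P X Y) = Id K (Sum P X Y)"
  by (rule Sum_ext[of X Y "Sum P X Y"]) (simp_all add: assms)

end

locale zero_endofunctor = coproduct_category K P
  for K :: "('o, 'm) cat" and P :: "('o, 'm) coprods" +
  fixes z :: "'o \<Rightarrow> 'o \<Rightarrow> 'm" and G :: "('o, 'm, 'o, 'm) func"
  assumes zero_morphisms: "zero_morphisms K z"
    and functor_G: "is_functor K K G"
begin

lemma zero_in_Hom [simp]: "\<lbrakk>X \<in> Ob K; Y \<in> Ob K\<rbrakk> \<Longrightarrow> z X Y \<in> Hom K X Y"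
  using zero_morphisms by (simp add: zero_morphisms_def)

lemma Comp_zero_right [simp]:
  "\<lbrakk>X \<in> Ob K; Y \<in> Ob K; Z \<in> Ob K; f \<in> Hom K Y Z\<rbrakk> \<Longrightarrow> Comp K X Y Z f (z X Y) = z X Z"
  using zero_morphisms zero_in_Hom unfolding zero_morphisms_def by blast

lemma Comp_zero_left [simp]:
  "\<lbrakk>X \<in> Ob K; Y \<in> Ob K; Z \<in> Ob K; g \<in> Hom K X Y\<rbrakk> \<Longrightarrow> Comp K X Y Z (z Y Z) g = z X Z"
  using zero_morphisms zero_in_Hom unfolding zero_morphisms_def by blast

lemma Fob_in_Ob [simp]: "X \<in> Ob K \<Longrightarrow> Fob G X \<in> Ob K"
  using functor_G by (simp add: is_functor_def)

lemma Map_in_Hom [simp]: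
  "\<lbrakk>X \<in> Ob K; Y \<in> Ob K; f \<in> Hom K X Y\<rbrakk> \<Longrightarrow> Map G X Y f \<in> Hom K (Fob G X) (Fob G Y)"
  using functor_G by (simp add: is_functor_def)

lemma Map_Id [simp]: "X \<in> Ob K \<Longrightarrow> Map G X X (Id K X) = Id K (Fob G X)"
  using functor_G by (simp add: is_functor_def)

text \<open>Oriented to fuse two images under \<open>G\<close> into one, so that equations about
  \<open>proj\<close> can be rewritten inside \<open>Map G\<close>.\<close>

lemma Map_Comp:
  "\<lbrakk>X \<in> Ob K; Y \<in> Ob K; Z \<in> Ob K; f \<in> Hom K X Y; g \<in> Hom K Y Z\<rbrakk>
    \<Longrightarrow> Comp K (Fob G X) (Fob G Y) (Fob G Z) (Map G Y Z g) (Map G X Y f) =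
        Map G X Z (Comp K X Y Z g f)"
  using functor_G unfolding is_functor_def by metis

abbreviation S where "S X \<equiv> Sum P (Fob G X) X"

text \<open>The action of \<open>G + Id\<close> with \<open>sum_map\<close> already unfolded to a
  cotuple, so that the cotuple rules apply directly.\<close>

abbreviation S_map where
  "S_map X Y f \<equiv> cotuple K P (Fob G X) X (S Y)
     (Comp K (Fob G X) (Fob G Y) (S Y) (inl P (Fob G Y) Y) (Map G X Y f))
     (Comp K X Y (S Y) (inr P (Fob G Y) Y) f)"

abbreviation proj where
  "proj X \<equiv> cotuple K P (Fob G X) X X (z (Fob G X) X) (Id K X)"

abbreviation mult where
  "mult X \<equiv> cotuple K P (Fob G (S X)) (S X) (S X)
     (Comp K (Fob G (S X)) (Fob G X) (S X) (inl P (Fob G X) X) (Map G (S X) X (proj X)))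
     (Id K (S X))"

lemma sum_id_mult_eq:
  assumes "X \<in> Ob K"
  shows "sum_id_mult K P z G X = mult X"
  unfolding sum_id_mult_def sum_map_def Let_def
  by (rule Sum_ext[of "Fob G (S X)" "S X" "S X"]) (simp_all add: assms Comp_assoc)

text \<open>Both sides are zero on the left summand, as zero absorbs \<open>Map G X Y f\<close> as
  well as \<open>f\<close>, and both are \<open>f\<close> on the right one.\<close>

lemma proj_natural:
  assumes "X \<in> Ob K" "Y \<in> Ob K" "f \<in> Hom K X Y"
  shows "Comp K (S X) (S Y) Y (proj Y) (S_map X Y f) = Comp K (S X) X Y f (proj X)"
  by (rule Sum_ext[of "Fob G X" X Y]) (simp_all add: assms Comp_assoc)

lemma proj_mult:
  assumes "X \<in> Ob K"
  shows "Comp K (S (S X)) (S X) X (proj X) (mult X) =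
    Comp K (S (S X)) (S X) X (proj X) (proj (S X))"
  by (rule Sum_ext[of "Fob G (S X)" "S X" X]) (simp_all add: assms Comp_assoc)

lemma S_map_Comp:
  assumes "X \<in> Ob K" "Y \<in> Ob K" "Z \<in> Ob K" "f \<in> Hom K X Y" "g \<in> Hom K Y Z"
  shows "S_map X Z (Comp K X Y Z g f) = Comp K (S X) (S Y) (S Z) (S_map Y Z g) (S_map X Y f)"
  by (rule Sum_ext[of "Fob G X" X "S Z"]) (simp_all add: assms Comp_assoc Map_Comp)

text \<open>On the left summand both sides are \<open>inl\<close> after \<open>G\<close> applied to
  a side of \<open>proj_natural\<close>; on the right one both are
  \<open>S_map X Y f\<close>.\<close>

lemma mult_natural:
  assumes "X \<in> Ob K" "Y \<in> Ob K" "f \<in> Hom K X Y"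
  shows "Comp K (S (S X)) (S (S Y)) (S Y) (mult Y) (S_map (S X) (S Y) (S_map X Y f)) =
    Comp K (S (S X)) (S X) (S Y) (S_map X Y f) (mult X)"
  by (rule Sum_ext[of "Fob G (S X)" "S X" "S Y"])
    (simp_all add: assms Comp_assoc Map_Comp proj_natural)

text \<open>On the left summand both sides are \<open>inl\<close> after \<open>G\<close> applied to
  a side of \<open>proj_mult\<close>; on the right one both are \<open>mult X\<close>.\<close>

lemma mult_assoc:
  assumes "X \<in> Ob K"
  shows "Comp K (S (S (S X))) (S (S X)) (S X) (mult X) (S_map (S (S X)) (S X) (mult X)) =
    Comp K (S (S (S X))) (S (S X)) (S X) (mult X) (mult (S X))"
  by (rule Sum_ext[of "Fob G (S (S X))" "S (S X)" "S X"])
    (simp_all add: assms Comp_assoc Map_Comp proj_mult)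

text \<open>On the left summand \<open>proj X\<close> cancels \<open>inr\<close> under
  \<open>G\<close>, which leaves \<open>inl\<close>; on the right one \<open>mult X\<close> cancels
  the outer \<open>inr\<close>.\<close>

lemma mult_S_map_unit:
  assumes "X \<in> Ob K"
  shows "Comp K (S X) (S (S X)) (S X) (mult X) (S_map X (S X) (inr P (Fob G X) X)) = Id K (S X)"
  by (rule Sum_ext[of "Fob G X" X "S X"]) (simp_all add: assms Comp_assoc Map_Comp)

lemma sum_func_simps:
  "Fob (sum_func K P G id_func) X = S X"
  "Map (sum_func K P G id_func) X Y f = S_map X Y f"
  by (simp_all add: sum_func_def id_func_def sum_map_def)

lemma is_functor_sum_func: "is_functor K K (sum_func K P G id_func)"
  unfolding is_functor_def sum_func_simps
  by (intro conjI ballI category) (simp_all add: cotuple_inl_inr S_map_Comp)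

lemma nat_trans_mult:
  "nat_trans K K (comp_func (sum_func K P G id_func) (sum_func K P G id_func))
     (sum_func K P G id_func) (sum_id_mult K P z G)"
proof -
  have "is_functor K K (comp_func (sum_func K P G id_func) (sum_func K P G id_func))"
    using is_functor_sum_func unfolding is_functor_def comp_func_def by simp
  then show ?thesis
    using is_functor_sum_func mult_natural
    by (simp add: nat_trans_def comp_func_def sum_func_simps sum_id_mult_eq)
qed

lemma nat_trans_unit: "nat_trans K K id_func (sum_func K P G id_func) (sum_id_unit P G)"
proof -
  have "is_functor K K id_func"
    using category by (simp add: is_functor_def id_func_def)
  then show ?thesis
    using is_functor_sum_func
    \<comment> \<open>\<open>id_func\<close> is unfolded only in a second pass, because
      \<open>sum_func_simps\<close> matches it folded.\<close>
    by (simp add: nat_trans_def sum_func_simps sum_id_unit_def) (simp add: id_func_def)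
qed

lemma is_monad_sum_id:
  "is_monad K (sum_func K P G id_func) (sum_id_mult K P z G) (sum_id_unit P G)"
  unfolding is_monad_def
  \<comment> \<open>The remaining unit law, for the unit at \<open>S X\<close>, is an instance of
    \<open>cotuple_inr\<close>.\<close>
  by (intro conjI ballI is_functor_sum_func nat_trans_mult nat_trans_unit)
    (simp_all add: sum_func_simps sum_id_mult_eq sum_id_unit_def mult_assoc mult_S_map_unit)

end

theorem theorem4p3:
  fixes C :: "('o, 'm) cat"
    and P :: "('o, 'm) coprods"
    and T F F' :: "('o, 'm, 'o, 'm) func"
    and \<mu> \<eta> :: "'o \<Rightarrow> 'm"
    and z :: "'o \<Rightarrow> 'o \<Rightarrow> 'm"
  assumes "category C"
    and "binary_coproducts C P"
    and "is_monad C T \<mu> \<eta>"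
    and "is_functor C C F"
    and "is_lifting C T \<mu> \<eta> F F'"
    and "zero_morphisms (kleisli C T \<mu> \<eta>) z"
  shows "is_monad (kleisli C T \<mu> \<eta>)
           (sum_func (kleisli C T \<mu> \<eta>) (kleisli_coprods C T \<eta> P) F' id_func)
           (sum_id_mult (kleisli C T \<mu> \<eta>) (kleisli_coprods C T \<eta> P) z F')
           (sum_id_unit (kleisli_coprods C T \<eta> P) F')"
proof -
  have "category (kleisli C T \<mu> \<eta>)"
    using assms(6) by (simp add: zero_morphisms_def)
  moreover have "is_functor (kleisli C T \<mu> \<eta>) (kleisli C T \<mu> \<eta>) F'"
    using assms(5) by (simp add: is_lifting_def)
  \<comment> \<open>The general result is applied to the Kleisli category, whose coproducts are
    those of \<open>C\<close> by \<open>binary_coproducts_kleisli\<close>, with the lifted functor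
    \<open>F'\<close> as \<open>G\<close>.\<close>
  ultimately interpret
    zero_endofunctor "kleisli C T \<mu> \<eta>" "kleisli_coprods C T \<eta> P" z F'
    using assms(6) binary_coproducts_kleisli[OF assms(3,2)] by unfold_locales
  show ?thesis by (rule is_monad_sum_id)
qed

end
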